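(* If $G$ is a finite group, then the graph $\Delta(G)$ is connected.
   Context: Let $G$ be a finite group. A generating set $X$ of $G$ is minimal if no proper subset of $X$ generates $G$. The independence graph $\Gamma(G)$ is the simple graph whose vertices are the elements of $G$ and in which $x$ and $y$ are joined by an edge if and only if $x\neq y$ and there exists a minimal generating set of $G$ containing both $x$ and $y$. $V(G)$ denotes the set of non-isolated vertices of $\Gamma(G)$, and $\Delta(G)$ is the subgraph of $\Gamma(G)$ induced by $V(G)$. "Connected" means that any two vertices are joined by a path; the graph with empty vertex set is regarded as connected. *)

theory Defs
  imports "HOL-Algebra.Generated_Groups" "Graph_Theory.Digraph_Component"
begin

definition minimal_generating_set :: "('a, 'b) monoid_scheme \<Rightarrow> 'a set \<Rightarrow> bool" where
  "minimal_generating_set G X \<longleftrightarrow>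
     X \<subseteq> carrier G \<and> generate G X = carrier G \<and> (\<forall>Y. Y \<subset> X \<longrightarrow> generate G Y \<noteq> carrier G)"

text \<open>
  Following Graph_Theory, a simple graph is a symmetric loop-free digraph whose arcs are pairs
  of vertices, so an edge between x and y is represented by both (x, y) and (y, x).
\<close>

definition independence_graph :: "('a, 'b) monoid_scheme \<Rightarrow> ('a, 'a \<times> 'a) pre_digraph" where
  "independence_graph G = with_proj
     \<lparr> pverts = carrier G,
       parcs = {(x, y). x \<noteq> y \<and> (\<exists>X. minimal_generating_set G X \<and> x \<in> X \<and> y \<in> X)} \<rparr>"

definition non_isolated_verts :: "('v, 'e) pre_digraph \<Rightarrow> 'v set" where
  "non_isolated_verts H = {x \<in> verts H. \<exists>y \<in> verts H. x \<rightarrow>\<^bsub>H\<^esub> y}"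

definition independence_graph_core :: "('a, 'b) monoid_scheme \<Rightarrow> ('a, 'a \<times> 'a) pre_digraph" where
  "independence_graph_core G =
     induce_subgraph (independence_graph G) (non_isolated_verts (independence_graph G))"

text \<open>
  The library predicate \<open>connected\<close> is false for the graph without vertices. That graph does
  arise here, e.g. for the trivial group and for cyclic groups of prime order, and it counts as
  connected.
\<close>

definition connected_or_null :: "('v, 'e) pre_digraph \<Rightarrow> bool" where
  "connected_or_null H \<longleftrightarrow> verts H = {} \<or> Digraph_Component.connected H"

lemma graph_independence_graph:
  assumes "finite (carrier G)"
  shows "graph (independence_graph G)"
proof -
  let ?P = "\<lparr> pverts = carrier G,
    parcs = {(x, y). x \<noteq> y \<and> (\<exists>X. minimal_generating_set G X \<and> x \<in> X \<and> y \<in> X)} \<rparr>"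
  have sub: "parcs ?P \<subseteq> carrier G \<times> carrier G"
    by (auto simp: minimal_generating_set_def)
  have "finite (parcs ?P)"
    using finite_subset[OF sub] assms by blast
  moreover have "symmetric (with_proj ?P)"
    by (auto simp: symmetric_def sym_def)
  ultimately interpret pair_graph ?P
    using sub assms by unfold_locales auto
  show ?thesis
    unfolding independence_graph_def by unfold_locales
qed

lemma connected_or_null_core_iff:
  "connected_or_null (independence_graph_core G) \<longleftrightarrow>
     (\<forall>x \<in> verts (independence_graph_core G). \<forall>y \<in> verts (independence_graph_core G).
        x \<rightarrow>\<^sup>*\<^bsub>independence_graph_core G\<^esub> y)"
proof -
  let ?D = "independence_graph_core G"
  have "arcs_ends (with_proj (mk_symmetric ?D)) = arcs_ends ?D"
    by (auto simp: mk_symmetric_def independence_graph_core_def independence_graph_def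
        induce_subgraph_def arcs_ends_conv image_iff)
  moreover have "verts (with_proj (mk_symmetric ?D)) = verts ?D"
    by (simp add: mk_symmetric_def)
  ultimately have "\<And>x y. x \<rightarrow>\<^sup>*\<^bsub>with_proj (mk_symmetric ?D)\<^esub> y \<longleftrightarrow> x \<rightarrow>\<^sup>*\<^bsub>?D\<^esub> y"
    by (simp add: reachable_def)
  then show ?thesis
    by (auto simp: connected_or_null_def Digraph_Component.connected_def strongly_connected_def
        mk_symmetric_def)
qed

end

(*
  A vertex of the graph is an element x that generates a proper subgroup and avoids some maximal
  subgroup M. Choose A maximal among the subsets of M with <A, x> \<noteq> G; then A is a proper
  subgroup of M and x is adjacent to every element of M - A. No group is the union of two proper
  subgroups, so two vertices that avoid the same maximal subgroup have a common neighbour.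
  Now let x avoid M and let y avoid N. If there is a third maximal subgroup K, then some element of
  K lies neither in M nor in N, and it is linked to both x and y. Otherwise x lies in N and y in M,
  and {x, y} is a minimal generating set.
*)
theory Submission
  imports Defs
begin

section \<open>Adjacency at the level of the group, and its agreement with the core\<close>

definition maximal_subgroup :: "('a, 'b) monoid_scheme \<Rightarrow> 'a set \<Rightarrow> bool" where
  "maximal_subgroup G M \<longleftrightarrow> subgroup M G \<and> M \<noteq> carrier G \<and>
     (\<forall>H. subgroup H G \<longrightarrow> M \<subseteq> H \<longrightarrow> H = M \<or> H = carrier G)"

text \<open>Adjacency freed from the digraph records, so that the group theory can be done without
  them.\<close>

definition independent_pair :: "('a, 'b) monoid_scheme \<Rightarrow> 'a \<Rightarrow> 'a \<Rightarrow> bool" where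
  "independent_pair G x y \<longleftrightarrow> x \<noteq> y \<and> (\<exists>X. minimal_generating_set G X \<and> x \<in> X \<and> y \<in> X)"

lemma independent_pair_sym: "independent_pair G x y \<Longrightarrow> independent_pair G y x"
  unfolding independent_pair_def by blast

lemma independent_pair_carrier:
  "independent_pair G x y \<Longrightarrow> x \<in> carrier G \<and> y \<in> carrier G"
  unfolding independent_pair_def minimal_generating_set_def by blast

text \<open>Both ends of an edge are non-isolated, so restricting to the core loses no edge.\<close>

lemma dominates_core_iff:
  "x \<rightarrow>\<^bsub>independence_graph_core G\<^esub> y \<longleftrightarrow> independent_pair G x y"
proof -
  have arc: "u \<rightarrow>\<^bsub>independence_graph G\<^esub> v \<longleftrightarrow> independent_pair G u v" for u v
    by (auto simp: independence_graph_def independent_pair_def arcs_ends_conv)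
  have non_isolated: "u \<in> non_isolated_verts (independence_graph G)" if "independent_pair G u v" for u v
    using that independent_pair_carrier[OF that]
    by (auto simp: non_isolated_verts_def arc) (auto simp: independence_graph_def)
  show ?thesis
    using non_isolated[of x y] non_isolated[of y x] independent_pair_sym[of G x y] arc[of x y]
    by (auto simp: independence_graph_core_def induce_subgraph_def independence_graph_def arcs_ends_conv)
qed

lemma verts_core:
  "verts (independence_graph_core G) = {x. \<exists>y. independent_pair G x y}"
proof -
  have "verts (independence_graph_core G) = {x \<in> carrier G. \<exists>y \<in> carrier G. independent_pair G x y}"
    by (auto simp: independence_graph_core_def independence_graph_def induce_subgraph_def
        non_isolated_verts_def arcs_ends_conv independent_pair_def)
  then show ?thesis
    using independent_pair_carrier by fast
qed

lemma wf_digraph_core: "wf_digraph (independence_graph_core G)"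
  by unfold_locales (auto simp: independence_graph_core_def independence_graph_def induce_subgraph_def)

section \<open>Subgroups, generation and adjacency in a group\<close>

context group
begin

text \<open>If \<open>a\<close> and \<open>b\<close> in \<open>K\<close> witness the two failures,
  then \<open>a\<close> lies in \<open>H'\<close> and \<open>b\<close> in \<open>H\<close>, so
  cancelling a factor of \<open>a \<otimes> b\<close> puts \<open>a\<close> into \<open>H\<close> or
  \<open>b\<close> into \<open>H'\<close>.\<close>

lemma subgroup_subset_Un:
  assumes "subgroup K G" "subgroup H G" "subgroup H' G" "K \<subseteq> H \<union> H'"
  shows "K \<subseteq> H \<or> K \<subseteq> H'"
proof (rule ccontr)
  assume "\<not> (K \<subseteq> H \<or> K \<subseteq> H')"
  then obtain a b where ab: "a \<in> K" "a \<notin> H" "b \<in> K" "b \<notin> H'"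
    by blast
  then have mem: "a \<in> H'" "b \<in> H"
    using assms(4) by auto
  have carr: "a \<in> carrier G" "b \<in> carrier G"
    using ab assms(1) subgroup.mem_carrier by metis+
  have "a \<otimes> b \<in> K"
    using ab assms(1) by (simp add: subgroup.m_closed)
  with assms(4) consider "a \<otimes> b \<in> H" | "a \<otimes> b \<in> H'"
    by auto
  then show False
  proof cases
    case 1
    then have "a \<otimes> b \<otimes> inv b \<in> H"
      using mem assms(2) by (simp add: subgroup.m_closed subgroup.m_inv_closed)
    then show False
      using ab carr by (simp add: m_assoc)
  next
    case 2
    then have "inv a \<otimes> (a \<otimes> b) \<in> H'"
      using mem assms(3) by (simp add: subgroup.m_closed subgroup.m_inv_closed)
    then show False
      using ab carr by (simp add: m_assoc[symmetric])
  qed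
qed

lemma ex_maximal_subgroup:
  assumes "finite (carrier G)" "subgroup H G" "H \<noteq> carrier G"
  shows "\<exists>M. maximal_subgroup G M \<and> H \<subseteq> M"
proof -
  let ?S = "{K. subgroup K G \<and> K \<noteq> carrier G}"
  have "finite ?S"
    by (rule finite_subset[of _ "Pow (carrier G)"]) (use assms(1) subgroup.subset in auto)
  then obtain M where "M \<in> ?S" "H \<subseteq> M" "\<And>K. K \<in> ?S \<Longrightarrow> M \<subseteq> K \<Longrightarrow> M = K"
    using finite_has_maximal2[of ?S H] assms by auto
  then show ?thesis
    unfolding maximal_subgroup_def by blast
qed

lemma subset_generate: "A \<subseteq> generate G A"
  using generate.incl by fast

lemma generate_eq_carrierI:
  assumes "finite (carrier G)" "A \<subseteq> carrier G" "\<And>M. maximal_subgroup G M \<Longrightarrow> \<not> A \<subseteq> M"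
  shows "generate G A = carrier G"
  using ex_maximal_subgroup[OF assms(1) generate_is_subgroup[OF assms(2)]] assms(3)
    subset_generate by blast

text \<open>Shrink \<open>A\<close> to a minimal \<open>B\<close> that still generates together with
  \<open>x\<close> and \<open>y\<close>. No element of \<open>B\<close> can then be dropped by
  minimality, and neither \<open>x\<close> nor \<open>y\<close> by \<open>nx\<close> and
  \<open>ny\<close>.\<close>

lemma independent_pairI:
  assumes fin: "finite (carrier G)"
    and sub: "A \<subseteq> carrier G" "x \<in> carrier G" "y \<in> carrier G"
    and gen: "generate G (insert x (insert y A)) = carrier G"
    and nx: "generate G (insert x A) \<noteq> carrier G" and ny: "generate G (insert y A) \<noteq> carrier G"
  shows "independent_pair G x y"
proof -
  have not_gen: "generate G C \<noteq> carrier G"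
    if "C \<subseteq> D" "D \<subseteq> carrier G" "generate G D \<noteq> carrier G" for C D
    using that mono_generate[of C D] generate_incl[of D] by blast
  let ?S = "{B. B \<subseteq> A \<and> generate G (insert x (insert y B)) = carrier G}"
  have "finite A"
    using fin sub(1) finite_subset by blast
  then have "finite ?S"
    by simp
  then obtain B where B: "B \<in> ?S" "\<And>C. C \<in> ?S \<Longrightarrow> C \<subseteq> B \<Longrightarrow> B = C"
    using finite_has_minimal2[of ?S A] gen by auto
  have "minimal_generating_set G (insert x (insert y B))"
    unfolding minimal_generating_set_def
  proof (intro conjI allI impI)
    fix Y assume Y: "Y \<subset> insert x (insert y B)"
    then obtain w where w: "w \<in> insert x (insert y B)" "w \<notin> Y"
      by blast
    show "generate G Y \<noteq> carrier G"
    proof (cases "w = x \<or> w = y")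
      case True
      then have "Y \<subseteq> insert x A \<or> Y \<subseteq> insert y A"
        using Y w B(1) by auto
      then show ?thesis
        using not_gen[of Y "insert x A"] not_gen[of Y "insert y A"] nx ny sub by auto
    next
      case False
      then have "w \<in> B" "Y \<subseteq> insert x (insert y (B - {w}))"
        using Y w by auto
      moreover from \<open>w \<in> B\<close> have "generate G (insert x (insert y (B - {w}))) \<noteq> carrier G"
        using B(1) B(2)[of "B - {w}"] by blast
      ultimately show ?thesis
        using not_gen[of Y "insert x (insert y (B - {w}))"] B(1) sub by auto
    qed
  qed (use B(1) sub in auto)
  \<comment> \<open>If they were equal, \<open>gen\<close> would collapse to the negation of
    \<open>nx\<close>.\<close>
  moreover have "x \<noteq> y"
    using gen nx by (metis insert_absorb2)
  ultimately show ?thesis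
    unfolding independent_pair_def by blast
qed

text \<open>In a minimal generating set \<open>X\<close> containing both, \<open>{x}\<close> is a
  proper subset because of \<open>y\<close>. A maximal subgroup above \<open>X - {x}\<close> must
  miss \<open>x\<close>, or it would contain all of \<open>X\<close>.\<close>

lemma independent_pair_avoids_maximal:
  assumes "finite (carrier G)" "independent_pair G x y"
  shows "generate G {x} \<noteq> carrier G" "\<exists>M. maximal_subgroup G M \<and> x \<notin> M"
proof -
  obtain X where X: "x \<noteq> y" "minimal_generating_set G X" "x \<in> X" "y \<in> X"
    using assms(2) unfolding independent_pair_def by blast
  then have X': "X \<subseteq> carrier G" "generate G X = carrier G"
    "\<And>Y. Y \<subset> X \<Longrightarrow> generate G Y \<noteq> carrier G"
    unfolding minimal_generating_set_def by auto
  show "generate G {x} \<noteq> carrier G"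
    using X X'(3)[of "{x}"] by blast
  have sub: "X - {x} \<subseteq> carrier G"
    using X' by blast
  obtain M where M: "maximal_subgroup G M" "X - {x} \<subseteq> M"
    using generate_eq_carrierI[OF assms(1) sub] X'(3)[of "X - {x}"] X(3) by blast
  have "x \<notin> M"
  proof
    assume "x \<in> M"
    with M(2) have "X \<subseteq> M"
      by blast
    then have "generate G X \<subseteq> M"
      using M(1) generate_subgroup_incl[of X M] unfolding maximal_subgroup_def by metis
    then show False
      using X'(2) M(1) subgroup.subset unfolding maximal_subgroup_def by (metis subset_antisym)
  qed
  with M(1) show "\<exists>M. maximal_subgroup G M \<and> x \<notin> M"
    by blast
qed

lemma maximal_subgroup_neighbours:
  assumes fin: "finite (carrier G)" and M: "maximal_subgroup G M"
    and x: "x \<in> carrier G" "x \<notin> M" "generate G {x} \<noteq> carrier G"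
  shows "\<exists>H. subgroup H G \<and> H \<subset> M \<and> (\<forall>y \<in> M - H. independent_pair G x y)"
proof -
  have Msub: "subgroup M G" "M \<subseteq> carrier G"
    using M subgroup.subset unfolding maximal_subgroup_def by auto
  let ?S = "{A. A \<subseteq> M \<and> generate G (insert x A) \<noteq> carrier G}"
  have "finite ?S"
    using finite_subset[OF Msub(2) fin] by simp
  \<comment> \<open>The family contains the empty set because \<open>x\<close> alone does not
    generate the group.\<close>
  then obtain H where H: "H \<in> ?S" "\<And>C. C \<in> ?S \<Longrightarrow> H \<subseteq> C \<Longrightarrow> H = C"
    using finite_has_maximal2[of ?S "{}"] x(3) by auto
  have Hsub: "H \<subseteq> carrier G"
    using H(1) Msub by blast
  have incl: "generate G H \<subseteq> M"
    using generate_subgroup_incl[of H M] H(1) Msub by blast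
  \<comment> \<open>Enlarging \<open>H\<close> to the subgroup it generates keeps it inside
    \<open>M\<close> and adds nothing to what it generates with \<open>x\<close>. By maximality
    \<open>H\<close> is already that subgroup.\<close>
  have "insert x (generate G H) \<subseteq> generate G (insert x H)"
    using mono_generate[of H "insert x H"] generate.incl[of x "insert x H"] by blast
  then have "generate G (insert x (generate G H)) \<subseteq> generate G (insert x H)"
    using generate_subgroup_incl generate_is_subgroup[of "insert x H"] Hsub x(1) by blast
  moreover have "generate G (insert x H) \<subset> carrier G"
    using H(1) generate_incl[of "insert x H"] Hsub x(1) by blast
  ultimately have "generate G H \<in> ?S"
    using incl by blast
  then have "H = generate G H"
    using H(2)[of "generate G H"] subset_generate by blast
  then have Hgrp: "subgroup H G"
    using generate_is_subgroup[OF Hsub] by simp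
  \<comment> \<open>This keeps \<open>M\<close> itself out of \<open>?S\<close>, so \<open>H\<close>
    is a proper subgroup of \<open>M\<close>.\<close>
  have gen_M: "generate G (insert x M) = carrier G"
  proof -
    have "insert x M \<subseteq> carrier G"
      using x Msub by blast
    then have "subgroup (generate G (insert x M)) G" "insert x M \<subseteq> generate G (insert x M)"
      using generate_is_subgroup subset_generate by auto
    then show ?thesis
      using M x(2) unfolding maximal_subgroup_def by blast
  qed
  have "independent_pair G x y" if y: "y \<in> M - H" for y
  proof (rule independent_pairI[OF fin Hsub])
    \<comment> \<open>\<open>insert y H\<close> is a strictly larger subset of \<open>M\<close>,
      hence outside \<open>?S\<close>.\<close>
    show "generate G (insert x (insert y H)) = carrier G"
      using H(1) H(2)[of "insert y H"] y by blast
    show "generate G (insert y H) \<noteq> carrier G"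
      using generate_subgroup_incl[of "insert y H" M] y H(1) Msub M
      unfolding maximal_subgroup_def by blast
  qed (use x y H(1) Msub in auto)
  moreover have "H \<subset> M"
    using H(1) gen_M by blast
  ultimately show ?thesis
    using Hgrp by blast
qed

text \<open>The elements of \<open>M\<close> not known to be adjacent to \<open>x\<close>, and
  likewise to \<open>y\<close>, lie in a proper subgroup of \<open>M\<close>, and two such subgroups
  do not cover \<open>M\<close>.\<close>

lemma common_neighbour:
  assumes fin: "finite (carrier G)" and M: "maximal_subgroup G M"
    and x: "x \<in> carrier G" "x \<notin> M" "generate G {x} \<noteq> carrier G"
    and y: "y \<in> carrier G" "y \<notin> M" "generate G {y} \<noteq> carrier G"
  shows "\<exists>z. independent_pair G x z \<and> independent_pair G z y"
proof -
  obtain H where H: "subgroup H G" "H \<subset> M" "\<forall>z \<in> M - H. independent_pair G x z"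
    using maximal_subgroup_neighbours[OF fin M x] by blast
  obtain H' where H': "subgroup H' G" "H' \<subset> M" "\<forall>z \<in> M - H'. independent_pair G y z"
    using maximal_subgroup_neighbours[OF fin M y] by blast
  have "\<not> M \<subseteq> H \<union> H'"
    using subgroup_subset_Un[of M H H'] M H H' unfolding maximal_subgroup_def by blast
  then show ?thesis
    using H(3) H'(3) independent_pair_sym by (meson DiffI UnCI subsetI)
qed

lemma independent_pair_connected:
  assumes fin: "finite (carrier G)" and "independent_pair G x x'" "independent_pair G y y'"
  shows "(independent_pair G)\<^sup>*\<^sup>* x y"
proof -
  have link: "(independent_pair G)\<^sup>*\<^sup>* u v"
    if "maximal_subgroup G M" "u \<in> carrier G" "u \<notin> M" "generate G {u} \<noteq> carrier G"
      "v \<in> carrier G" "v \<notin> M" "generate G {v} \<noteq> carrier G" for u v M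
    using common_neighbour[OF fin that] by (meson converse_rtranclp_into_rtranclp r_into_rtranclp)
  have carr: "x \<in> carrier G" "y \<in> carrier G"
    using assms independent_pair_carrier by metis+
  have nx: "generate G {x} \<noteq> carrier G" and ny: "generate G {y} \<noteq> carrier G"
    using assms independent_pair_avoids_maximal by blast+
  obtain M where M: "maximal_subgroup G M" "x \<notin> M"
    using assms independent_pair_avoids_maximal by blast
  obtain N where N: "maximal_subgroup G N" "y \<notin> N"
    using assms independent_pair_avoids_maximal by blast
  show ?thesis
  proof (cases "\<exists>K. maximal_subgroup G K \<and> K \<noteq> M \<and> K \<noteq> N")
    case True
    then obtain K where K: "maximal_subgroup G K" "K \<noteq> M" "K \<noteq> N"
      by blast
    then have "\<not> K \<subseteq> M" "\<not> K \<subseteq> N"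
      using M(1) N(1) unfolding maximal_subgroup_def by metis+
    then have "\<not> K \<subseteq> M \<union> N"
      using subgroup_subset_Un[of K M N] K(1) M(1) N(1) unfolding maximal_subgroup_def by metis
    then obtain z where z: "z \<in> K" "z \<notin> M" "z \<notin> N"
      by blast
    \<comment> \<open>Lying in the proper subgroup \<open>K\<close>, the element \<open>z\<close>
      cannot generate alone. So \<open>link\<close> applies with \<open>M\<close> between
      \<open>x\<close> and \<open>z\<close>, and with \<open>N\<close> between \<open>z\<close> and
      \<open>y\<close>.\<close>
    have K': "subgroup K G" "K \<subseteq> carrier G" "K \<noteq> carrier G"
      using K(1) subgroup.subset unfolding maximal_subgroup_def by auto
    then have z': "z \<in> carrier G" "generate G {z} \<noteq> carrier G"
      using z(1) generate_subgroup_incl[of "{z}" K] by auto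
    have "(independent_pair G)\<^sup>*\<^sup>* x z" "(independent_pair G)\<^sup>*\<^sup>* z y"
      using link M N z z' carr nx ny by blast+
    then show ?thesis
      by simp
  next
    case False
    then have only: "K = M \<or> K = N" if "maximal_subgroup G K" for K
      using that by blast
    \<comment> \<open>Any maximal subgroup is \<open>M\<close>, which misses \<open>x\<close>, or
      \<open>N\<close>, which misses \<open>y\<close>; the argument also allows
      \<open>M = N\<close>.\<close>
    have "generate G {x, y} = carrier G"
    proof (rule generate_eq_carrierI[OF fin])
      show "\<not> {x, y} \<subseteq> K" if "maximal_subgroup G K" for K
        using only[OF that] M(2) N(2) by auto
    qed (use carr in simp)
    then have "independent_pair G x y"
      using independent_pairI[OF fin, of "{}"] nx ny carr by simp
    then show ?thesis
      by blast
  qed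
qed

end

theorem theorem1:
  fixes G :: "('a, 'b) monoid_scheme"
  assumes "group G" and "finite (carrier G)"
  shows "connected_or_null (independence_graph_core G)"
  unfolding connected_or_null_core_iff
proof (intro ballI)
  interpret group G by fact
  interpret D: wf_digraph "independence_graph_core G" by (rule wf_digraph_core)
  fix x y
  assume xy: "x \<in> verts (independence_graph_core G)" "y \<in> verts (independence_graph_core G)"
  then have "(independent_pair G)\<^sup>*\<^sup>* x y"
    using independent_pair_connected[OF assms(2)] by (auto simp: verts_core)
  then show "x \<rightarrow>\<^sup>*\<^bsub>independence_graph_core G\<^esub> y"
  proof induction
    \<comment> \<open>The reflexive case of reachability requires \<open>x\<close> to be a
      vertex.\<close>
    case base
    show ?case
      using xy(1) by simp
  next
    case (step u v)
    then show ?case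
      using D.reachable_adj_trans by (simp add: dominates_core_iff)
  qed
qed

end
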